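(* Let $m\in\{4,5,6,7\}$. Then there exist a tree $S$ on $m$ vertices, a vertex $x$ of $S$, and real numbers $c_1,\dots,c_{m-1}$ with $c_{m-1}\neq 0$ such that the following holds. For every tree $R$ and every tree $T_n$ on $n$ vertices of the form $T_n=S\circ_x R$ (that is, $T_n$ is obtained from disjoint copies of $S$ and $R$ by identifying $x$ with a vertex of $R$, so $n=|V(R)|+m-1$), labelled as described in the context, the homogeneous linear $m$-term recurrence relation $$\det(D_n)+\sum_{i=1}^{m-1} c_i\,\det(D_{n-i})=0$$ holds, where for $n-m+1\le k\le n$, $D_k$ denotes the distance matrix of the subtree of $T_n$ induced by the vertex set $\{1,\dots,k\}$.
   Context: For a tree $T$ with vertex set $[n]=\{1,\dots,n\}$, its distance matrix is $D=(d_{i,j})_{i,j\in[n]}$, where $d_{i,j}$ is the number of edges of the unique path between $i$ and $j$ (and $d_{i,i}=0$). For trees $S$ (on $m\ge 2$ vertices) and $R$, and a vertex $x$ of $S$, $S\circ_x R$ denotes a tree decomposing into the subtree $S$ and the subtree $R$ which share exactly one common vertex, namely $x$. Labelling convention: the vertices of $R$ other than the common vertex are labelled $1,\dots,n-m$; the common vertex $x$ is labelled $n-m+1$; the remaining $m-1$ vertices of $S$ are labelled $n-m+2,\dots,n$ in nondecreasing order of their distance from $x$ in $S$. With this labelling each vertex set $\{1,\dots,k\}$ with $n-m+1\le k\le n$ induces a subtree of $T_n$, and $D_k$ is its distance matrix (equivalently, the leading principal $k\times k$ submatrix of the distance matrix $D_n$ of $T_n$). An "$m$-term" homogeneous linear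 recurrence is one involving $\det(D_n),\det(D_{n-1}),\dots,\det(D_{n-m+1})$ with nonzero coefficient on $\det(D_{n-m+1})$. *)

theory Defs
  imports
    "Graph_Theory.Digraph_Component"
    "Graph_Theory.Pair_Digraph"
    "Jordan_Normal_Form.Determinant"
begin

text \<open>
  Simple graphs are symmetric, loop-free, finite digraphs without parallel arcs
  (\<^locale>\<open>pair_graph\<close>). The library predicates \<^const>\<open>forest\<close> and \<^const>\<open>tree\<close> cannot be used
  for them: an undirected edge is a pair of opposite arcs, which \<^const>\<open>pre_digraph.cycle\<close> counts
  as a cycle of length 2. Hence only cycles of length at least 3 are excluded below. Trees are
  nonempty, since \<^const>\<open>strongly_connected\<close> requires a vertex.
\<close>

definition is_tree :: "'a pair_pre_digraph \<Rightarrow> bool" where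
  "is_tree G \<longleftrightarrow> pair_graph G \<and> Digraph_Component.connected (with_proj G) \<and>
     \<not> (\<exists>p. pre_digraph.cycle (with_proj G) p \<and> 3 \<le> length p)"

text \<open>Meaningful only for vertices joined by exactly one path.\<close>

definition tree_dist :: "('a, 'b) pre_digraph \<Rightarrow> 'a \<Rightarrow> 'a \<Rightarrow> nat" where
  "tree_dist G u v = length (THE p. pre_digraph.apath G u p v)"

text \<open>
  For vertex set \<open>{1..k}\<close>; matrix indices start at 0, vertices at 1.
\<close>

definition distance_matrix :: "(nat, 'b) pre_digraph \<Rightarrow> real mat" where
  "distance_matrix G = mat (card (verts G)) (card (verts G))
     (\<lambda>(i, j). real (tree_dist G (i + 1) (j + 1)))"

definition relabel :: "('a \<Rightarrow> 'b) \<Rightarrow> 'a pair_pre_digraph \<Rightarrow> 'b pair_pre_digraph" where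
  "relabel f G = \<lparr>pverts = f ` pverts G, parcs = map_prod f f ` parcs G\<rparr>"

text \<open>
  \<open>T\<close> is the graph \<open>S \<circ>\<^sub>x R\<close> in which \<open>x\<close> is identified with the vertex \<open>y\<close> of \<open>R\<close>;
  \<open>f\<close> and \<open>g\<close> embed \<open>S\<close> and \<open>R\<close> into \<open>T\<close>.
\<close>

definition is_coalescence ::
  "'c pair_pre_digraph \<Rightarrow> 'a pair_pre_digraph \<Rightarrow> 'a \<Rightarrow> 'b pair_pre_digraph \<Rightarrow> 'b
    \<Rightarrow> ('a \<Rightarrow> 'c) \<Rightarrow> ('b \<Rightarrow> 'c) \<Rightarrow> bool" where
  "is_coalescence T S x R y f g \<longleftrightarrow>
     x \<in> pverts S \<and> y \<in> pverts R \<and>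
     inj_on f (pverts S) \<and> inj_on g (pverts R) \<and> f x = g y \<and>
     f ` pverts S \<inter> g ` pverts R = {f x} \<and>
     pverts T = pverts (relabel f S) \<union> pverts (relabel g R) \<and>
     parcs T = parcs (relabel f S) \<union> parcs (relabel g R)"

text \<open>
  With \<open>m\<close> vertices in \<open>S\<close> and \<open>n\<close> in \<open>T\<close>, the common vertex gets label
  \<open>n - m + 1\<close>, which is the number of vertices of \<open>R\<close>.
\<close>

definition is_labelling ::
  "'a pair_pre_digraph \<Rightarrow> 'a \<Rightarrow> 'b pair_pre_digraph \<Rightarrow> 'b \<Rightarrow> ('a \<Rightarrow> nat) \<Rightarrow> ('b \<Rightarrow> nat) \<Rightarrow> bool" where
  "is_labelling S x R y f g \<longleftrightarrow>
     (let r = card (pverts R); n = r + card (pverts S) - 1 in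
       g ` (pverts R - {y}) = {1..r - 1} \<and> f x = r \<and>
       f ` (pverts S - {x}) = {r + 1..n} \<and>
       (\<forall>u \<in> pverts S - {x}. \<forall>v \<in> pverts S - {x}. f u < f v \<longrightarrow>
          tree_dist (with_proj S) x u \<le> tree_dist (with_proj S) x v))"

end

theory Submission
  imports Defs
begin

text \<open>
  Take for \<open>S\<close> the star with centre \<open>x\<close>. Two leaves hanging at the same vertex have equal distances to
  all other vertices, and distance 2 from each other. Subtracting one of their rows from the other
  and expanding gives \<open>det D\<^bsub>k+2\<^esub> + 4 det D\<^bsub>k+1\<^esub> + 4 det D\<^sub>k = 0\<close> as soon as \<open>{1..k}\<close> contains
  \<open>R\<close>. Adding two shifted copies of this relation produces a recurrence of order \<open>m - 1\<close>.
\<close>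

section \<open>Determinant relation for two twin leaves\<close>

text \<open>The indices \<open>k\<close> and \<open>Suc k\<close> play the twin leaves. After the
  row subtraction the last row is zero except for the entries 2 and -2, and both minors reduce to
  leading principal determinants.\<close>

lemma det_two_twin_leaves:
  fixes a :: "nat \<Rightarrow> nat \<Rightarrow> 'a :: comm_ring_1"
  defines "D \<equiv> \<lambda>k. mat k k (\<lambda>(i, j). a i j)"
  assumes row: "\<And>j. j < k \<Longrightarrow> a (Suc k) j = a k j"
    and col: "\<And>i. i < k \<Longrightarrow> a i (Suc k) = a i k"
    and diag: "a k k = 0" "a (Suc k) (Suc k) = 0"
    and off: "a k (Suc k) = 2" "a (Suc k) k = 2"
  shows "det (D (k + 2)) + 4 * det (D (k + 1)) + 4 * det (D k) = 0"
proof -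
  define B where "B = addrow (-1) (Suc k) k (D (k + 2))"
  define M where "M = mat_delete B (Suc k) k"
  have D: "D n \<in> carrier_mat n n" for n
    by (simp add: D_def)
  have B: "B \<in> carrier_mat (k + 2) (k + 2)"
    using D by (simp add: B_def)
  have M: "M \<in> carrier_mat (Suc k) (Suc k)"
    using mat_delete_carrier[OF B] by (simp add: M_def)
  have B_last: "B $$ (Suc k, j) = (if j = k then 2 else if j = Suc k then -2 else 0)"
    if "j < k + 2" for j
    using that row diag off by (auto simp: B_def D_def less_Suc_eq)
  \<comment> \<open>Deleting column \<open>k\<close> keeps column \<open>Suc k\<close>, which agrees
    with it above row \<open>k\<close>; so \<open>M\<close> is \<open>D (Suc k)\<close> with the
    corner entry raised from 0 to 2.\<close>
  have M_ix: "M $$ (i, j) = (if i = k \<and> j = k then 2 else a i j)" if "i < Suc k" "j < Suc k" for i j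
    using that col off by (auto simp: M_def mat_delete_def B_def D_def less_Suc_eq)
  have B_del: "mat_delete B (Suc k) (Suc k) = D (Suc k)"
    by (rule eq_matI) (auto simp: mat_delete_def B_def D_def)
  \<comment> \<open>The changed corner lies in row \<open>k\<close>, so the cofactors along that row
    are those of \<open>D (Suc k)\<close>, and the corner itself adds
    \<open>2 * det (D k)\<close>.\<close>
  have M_del: "mat_delete M k j = mat_delete (D (Suc k)) k j" for j
    using M by (intro eq_matI) (auto simp: mat_delete_def M_ix D_def)
  have del_k: "mat_delete (D (Suc k)) k k = D k"
    by (rule eq_matI) (auto simp: mat_delete_def D_def)
  have "det M = (\<Sum>j<Suc k. M $$ (k, j) * cofactor M k j)"
    by (rule laplace_expansion_row[OF M]) simp
  also have "\<dots> = (\<Sum>j<Suc k. D (Suc k) $$ (k, j) * cofactor (D (Suc k)) k j) + 2 * det (D k)"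
    by (simp add: M_ix cofactor_def M_del del_k) (simp add: D_def diag)
  also have "(\<Sum>j<Suc k. D (Suc k) $$ (k, j) * cofactor (D (Suc k)) k j) = det (D (Suc k))"
    by (rule laplace_expansion_row[OF D, symmetric]) simp
  finally have det_M: "det M = det (D (Suc k)) + 2 * det (D k)" .
  have "det (D (k + 2)) = det B"
    unfolding B_def by (rule det_addrow[symmetric, OF _ _ D]) auto
  also have "\<dots> = (\<Sum>j<k + 2. B $$ (Suc k, j) * cofactor B (Suc k) j)"
    by (rule laplace_expansion_row[OF B]) simp
  also have "\<dots> = 2 * cofactor B (Suc k) k - 2 * cofactor B (Suc k) (Suc k)"
    by (simp add: B_last)
  also have "\<dots> = - 2 * det M - 2 * det (D (Suc k))"
    by (simp add: cofactor_def B_del M_def)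
  finally show ?thesis
    by (simp add: det_M algebra_simps)
qed

section \<open>Uniqueness of paths in trees\<close>

lemma length_rev_path [simp]: "length (rev_path p) = length p"
  by (induction p) auto

text \<open>Induction strips equal first arcs, leaving two paths that diverge at their first
  step.\<close>

lemma (in pair_graph) acyclic_imp_apath_unique:
  assumes acyclic: "\<not> (\<exists>p. cycle p \<and> 3 \<le> length p)"
    and "apath u p v" "apath u q v"
  shows "p = q"
  using assms(2,3)
proof (induction p arbitrary: u q)
  case Nil
  then show ?case
    using apath_nonempty_ends by (auto simp: apath_Nil_iff)
next
  case (Cons e p)
  obtain a where e: "e = (u, a)"
    using Cons.prems by (cases e) (auto simp: apath_Cons_iff)
  have "q \<noteq> []"
    using Cons.prems apath_nonempty_ends by (auto simp: apath_Nil_iff)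
  then obtain b q' where q: "q = (u, b) # q'"
    using Cons.prems by (cases q) (auto simp: apath_Cons_iff)
  have p_path: "apath a p v" "u \<notin> set (awalk_verts a p)" "(u, a) \<in> parcs G"
    and q_path: "apath b q' v" "u \<notin> set (awalk_verts b q')" "(u, b) \<in> parcs G"
    using Cons.prems by (auto simp: e q apath_Cons_iff)
  show ?case
  proof (cases "a = b")
    case True
    then show ?thesis
      using Cons.IH p_path q_path by (auto simp: e q)
  next
    case False
    \<comment> \<open>The paths diverge at \<open>u\<close>; closing them up at the first common vertex \<open>w\<close> gives a cycle.\<close>
    have "v \<in> set (awalk_verts a p)" "v \<in> set (awalk_verts b q')"
      using p_path q_path by (metis awalkI_apath awalkE awalk_verts_non_Nil last_in_set)+
    then have "\<exists>w \<in> set (awalk_verts a p). w \<in> set (awalk_verts b q')"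
      by blast
    from split_list_first_prop[OF this] obtain xs w ys where p_split: "awalk_verts a p = xs @ w # ys"
      and w: "w \<in> set (awalk_verts b q')"
      and first: "\<forall>x \<in> set xs. x \<notin> set (awalk_verts b q')"
      by blast
    from w obtain zs ys' where q_split: "awalk_verts b q' = zs @ w # ys'"
      by (meson split_list)
    have "pcas a p v" "pcas b q' v"
      using p_path q_path by (auto simp: apath_def)
    obtain p1 p2 where p1: "p = p1 @ p2" "pcas a p1 w" "awalk_verts a p1 = xs @ [w]"
      using awalk_decomp_verts[OF \<open>pcas a p v\<close> p_split] by metis
    obtain q1 q2 where q1: "q' = q1 @ q2" "pcas b q1 w" "awalk_verts b q1 = zs @ [w]"
      using awalk_decomp_verts[OF \<open>pcas b q' v\<close> q_split] by metis
    have awp: "awalk u ((u, a) # p1) w"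
      using p_path p1 by (auto simp: apath_def awalk_def dest: in_arcsD1 in_arcsD2)
    have awq: "awalk u ((u, b) # q1) w"
      using q_path q1 by (auto simp: apath_def awalk_def dest: in_arcsD1 in_arcsD2)
    define c where "c = ((u, a) # p1) @ rev_path ((u, b) # q1)"
    have aw: "awalk u c u"
      unfolding c_def by (rule awalk_appendI[OF awp]) (use awq in \<open>simp del: rev_path.simps\<close>)
    have "awalk_verts u c = awalk_verts u ((u, a) # p1) @ tl (awalk_verts w (rev_path ((u, b) # q1)))"
      using awalk_verts_append[OF aw[unfolded c_def]] unfolding c_def by (simp add: p1)
    also have "\<dots> = u # xs @ w # rev zs @ [u]"
      unfolding awalk_verts_rev_path[OF awq] by (simp add: p1 q1)
    finally have verts: "awalk_verts u c = u # xs @ w # rev zs @ [u]" .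
    have "distinct (awalk_verts a p)" "distinct (awalk_verts b q')"
      using p_path q_path by (auto simp: apath_def)
    \<comment> \<open>The choice of \<open>w\<close> keeps \<open>xs\<close> apart from
      \<open>zs\<close>, and the path conditions keep \<open>u\<close> off both. Only the tail is
      tested because a cycle repeats its start vertex.\<close>
    then have "distinct (tl (awalk_verts u c))"
      using p_path q_path first by (auto simp: verts p_split q_split)
    then have "cycle c"
      using aw by (auto simp: cycle_def c_def)
    moreover have "length c = length xs + length zs + 2"
      using length_awalk_verts[of u c] by (simp add: verts)
    \<comment> \<open>If both were empty, \<open>w\<close> would equal both \<open>a\<close> and
      \<open>b\<close>. Hence the cycle is longer than an arc followed by its opposite.\<close>
    moreover have "xs \<noteq> [] \<or> zs \<noteq> []"
      using False p1 q1 by (cases p1; cases q1) auto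
    ultimately show ?thesis
      using acyclic by (cases xs; cases zs) auto
  qed
qed

lemma is_tree_ex1_apath:
  assumes "is_tree T" "u \<in> pverts T" "v \<in> pverts T"
  shows "\<exists>!p. pre_digraph.apath (with_proj T) u p v"
proof -
  interpret pair_graph T
    using assms by (simp add: is_tree_def)
  \<comment> \<open>\<open>connected\<close> refers to the symmetric closure, which has the same
    reachability as the symmetric graph itself.\<close>
  have "u \<rightarrow>\<^sup>*\<^bsub>mk_symmetric (with_proj T)\<^esub> v"
    using assms by (auto simp: is_tree_def connected_def)
  then have "\<exists>p. apath u p v"
    using reachable_mk_symmetric_eq[OF sym_arcs] reachable_apath by blast
  then show ?thesis
    using acyclic_imp_apath_unique assms by (auto simp: is_tree_def)
qed

section \<open>Distances in trees\<close>

text \<open>Uniqueness resolves the definite description in \<open>tree_dist\<close>, so exhibiting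
  any path suffices to compute a distance.\<close>

lemma tree_dist_eqI:
  assumes "is_tree T" "pre_digraph.apath (with_proj T) u p v"
  shows "tree_dist (with_proj T) u v = length p"
proof -
  interpret pair_graph T
    using assms by (simp add: is_tree_def)
  have "(THE p. apath u p v) = p"
    using assms acyclic_imp_apath_unique by (intro the_equality) (auto simp: is_tree_def)
  then show ?thesis
    by (simp add: tree_dist_def)
qed

lemma tree_dist_refl:
  assumes "is_tree T" "u \<in> pverts T"
  shows "tree_dist (with_proj T) u u = 0"
proof -
  interpret pair_graph T
    using assms by (simp add: is_tree_def)
  show ?thesis
    using assms tree_dist_eqI[of T u "[]" u] by (simp add: apath_Nil_iff)
qed

lemma tree_dist_sym:
  assumes "is_tree T" "u \<in> pverts T" "v \<in> pverts T"
  shows "tree_dist (with_proj T) u v = tree_dist (with_proj T) v u"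
proof -
  interpret pair_graph T
    using assms by (simp add: is_tree_def)
  obtain p where p: "apath u p v"
    using is_tree_ex1_apath[OF assms] by auto
  then have rev: "apath v (rev_path p) u"
    by simp
  show ?thesis
    using tree_dist_eqI[OF assms(1) p] tree_dist_eqI[OF assms(1) rev] by simp
qed

text \<open>The last arc of the path to \<open>l\<close> can only start in \<open>r\<close>;
  dropping it leaves the path to \<open>r\<close>.\<close>

lemma tree_dist_leaf:
  assumes "is_tree T" "u \<in> pverts T" "l \<in> pverts T" "u \<noteq> l"
    and leaf: "\<And>a. (a, l) \<in> parcs T \<Longrightarrow> a = r"
  shows "tree_dist (with_proj T) u l = tree_dist (with_proj T) u r + 1"
proof -
  interpret pair_graph T
    using assms by (simp add: is_tree_def)
  obtain p where p: "apath u p l"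
    using is_tree_ex1_apath[OF assms(1-3)] by auto
  then have "p \<noteq> []"
    using assms by (auto simp: apath_Nil_iff)
  then obtain q e where q: "p = q @ [e]"
    by (metis rev_exhaust)
  then have "apath u q (awlast u q)" "e \<in> parcs T" "fst e = awlast u q" "snd e = l"
    using p by (auto simp: apath_append_iff apath_Cons_iff apath_Nil_iff)
  moreover from this have "fst e = r"
    using leaf by (metis prod.collapse)
  ultimately show ?thesis
    using p assms(1) by (simp add: tree_dist_eqI q)
qed

text \<open>A path with both ends in \<open>V\<close> cannot visit a vertex outside
  \<open>V\<close>: it would have to enter from \<open>r\<close> and leave to \<open>r\<close>. Thus
  cutting off such leaves preserves distances.\<close>

lemma (in pair_graph) apath_induce_iff:
  assumes "V \<subseteq> pverts G" "u \<in> V" "v \<in> V"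
    and leaves: "\<And>x l. (x, l) \<in> parcs G \<Longrightarrow> l \<notin> V \<Longrightarrow> x = r"
  shows "pre_digraph.apath (with_proj G \<restriction> V) u p v \<longleftrightarrow> apath u p v"
proof
  interpret I: wf_digraph "with_proj G \<restriction> V"
    by (rule wellformed_induce_subgraph)
  have verts_eq: "I.awalk_verts = awalk_verts"
    using awalk_verts_induce by simp
  show "apath u p v" if "I.apath u p v"
  proof -
    have "subgraph (with_proj G \<restriction> V) (with_proj G)"
      using assms by (intro subgraph_induce_subgraphI) auto
    then show ?thesis
      using that subgraph_awalk_imp_awalk by (auto simp: I.apath_def apath_def verts_eq)
  qed
  assume p: "apath u p v"
  have heads: "y \<in> V" if arc: "(x, y) \<in> set p" for x y
  proof (rule ccontr)
    assume y: "y \<notin> V"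
    then obtain p1 z p2 where split: "p = p1 @ (x, y) # (y, z) # p2" "x \<noteq> z"
      using apath_succ_decomp[OF p arc] assms(3) by blast
    then have "(x, y) \<in> parcs G" "(y, z) \<in> parcs G"
      using p by (auto simp: apath_def awalk_def)
    then have "x = r" "z = r"
      using leaves[OF _ y] arcs_symmetric by blast+
    then show False
      using split by simp
  qed
  have "pcas u p v"
    using p by (auto simp: apath_def)
  then have "set (awalk_verts u p) \<subseteq> insert u (snd ` set p)"
    using awalk_verts_conv'[of u p v] by (cases p) auto
  then have "set (awalk_verts u p) \<subseteq> V"
    using heads assms by force
  then show "I.apath u p v"
    using p awalk_induce by (auto simp: I.apath_def apath_def verts_eq)
qed

section \<open>Stars and their coalescences\<close>

definition star :: "nat \<Rightarrow> nat pair_pre_digraph" where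
  "star m = \<lparr>pverts = {0..<m}, parcs = {0} \<times> {1..<m} \<union> {1..<m} \<times> {0}\<rparr>"

lemma is_tree_star:
  assumes "m \<ge> 1"
  shows "is_tree (star m)"
proof -
  interpret pair_graph "star m"
    by unfold_locales (auto simp: star_def symmetric_def sym_def)
  have arcs: "(a, b) \<in> parcs (star m) \<Longrightarrow> (a = 0) \<noteq> (b = 0)" for a b
    by (auto simp: star_def)
  have "0 \<rightarrow>\<^sup>*\<^bsub>with_proj (star m)\<^esub> v" "v \<rightarrow>\<^sup>*\<^bsub>with_proj (star m)\<^esub> 0" if "v \<in> pverts (star m)" for v
  proof -
    show "0 \<rightarrow>\<^sup>*\<^bsub>with_proj (star m)\<^esub> v"
    proof (cases "v = 0")
      case False
      then have "(0, v) \<in> parcs (star m)"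
        using that by (auto simp: star_def)
      then show ?thesis by auto
    qed (use that in auto)
    show "v \<rightarrow>\<^sup>*\<^bsub>with_proj (star m)\<^esub> 0"
    proof (cases "v = 0")
      case False
      then have "(v, 0) \<in> parcs (star m)"
        using that by (auto simp: star_def)
      then show ?thesis by auto
    qed (use that in auto)
  qed
  then have "u \<rightarrow>\<^sup>*\<^bsub>with_proj (star m)\<^esub> v" if "u \<in> pverts (star m)" "v \<in> pverts (star m)" for u v
    using that reachable_trans by blast
  then have conn: "Digraph_Component.connected (with_proj (star m))"
    using assms reachable_mk_symmetric_eq[OF sym_arcs]
    by (auto simp: connected_def strongly_connected_def) (auto simp: star_def)
  \<comment> \<open>Every arc has exactly one end at the centre 0, so three successive arcs
    \<open>a\<close>, \<open>b\<close>, \<open>c\<close>, \<open>d\<close> give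
    \<open>a = c = 0\<close> or \<open>b = d = 0\<close>. Either way 0 occurs twice in the vertex
    list without its head, which must be distinct.\<close>
  have "\<not> 3 \<le> length p" if cyc: "cycle p" for p
  proof
    assume "3 \<le> length p"
    \<comment> \<open>\<open>remdups_adj.cases\<close> serves as a case split into lists of length
      0, 1 and at least 2.\<close>
    then obtain a b b' c c' d p' where p: "p = (a, b) # (b', c) # (c', d) # p'"
      by (cases p rule: remdups_adj.cases; cases "tl (tl p)") auto
    obtain u where u: "awalk u p u" "distinct (tl (awalk_verts u p))"
      using cyc by (auto simp: cycle_def)
    have [simp]: "u = a" "b' = b" "c' = c"
      using u by (auto simp: p awalk_Cons_iff)
    have "distinct (b # c # awalk_verts d p')"
      using u by (simp add: p)
    moreover have "awalk d p' a" "(a, b) \<in> parcs (star m)" "(b, c) \<in> parcs (star m)"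
      "(c, d) \<in> parcs (star m)"
      using u by (auto simp: p awalk_Cons_iff)
    moreover from this have "a \<in> set (awalk_verts d p')" "d \<in> set (awalk_verts d p')"
      by (metis awalkE awalk_verts_non_Nil last_in_set hd_in_set)+
    ultimately show False
      using arcs by (metis distinct.simps(2) list.set_intros(1) list.set_intros(2))
  qed
  then show ?thesis
    using conn by (auto simp: is_tree_def pair_graph_axioms)
qed

text \<open>The copy of \<open>R\<close> occupies exactly the labels up to \<open>r\<close>, so an
  arc into a larger label comes from the star and starts at its centre, which is labelled
  \<open>r\<close>.\<close>

lemma star_coalescence:
  fixes T :: "nat pair_pre_digraph" and R :: "'b pair_pre_digraph"
  assumes R: "is_tree R"
    and coal: "is_coalescence T (star m) 0 R y f g" and lab: "is_labelling (star m) 0 R y f g"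
  defines "r \<equiv> card (pverts R)"
  shows "r \<ge> 1" "m \<ge> 1" "pverts T = {1..r + m - 1}"
    and "\<And>a l. (a, l) \<in> parcs T \<Longrightarrow> l > r \<Longrightarrow> a = r"
proof -
  interpret R: pair_graph R
    using R by (simp add: is_tree_def)
  have S: "pverts (star m) = {0..<m}" "parcs (star m) = {0} \<times> {1..<m} \<union> {1..<m} \<times> {0}"
    by (auto simp: star_def)
  have y: "y \<in> pverts R" and "f 0 = g y" and "m \<ge> 1"
    using coal by (auto simp: is_coalescence_def star_def)
  have r_pos: "r \<ge> 1"
    using y R.pair_finite_verts by (auto simp: r_def Suc_le_eq card_gt_0_iff)
  have labels: "g ` (pverts R - {y}) = {1..r - 1}" "f 0 = r"
    "f ` (pverts (star m) - {0}) = {r + 1..r + m - 1}"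
    using lab by (auto simp: is_labelling_def Let_def S r_def)
  have "g ` pverts R = insert (g y) (g ` (pverts R - {y}))"
    using y by blast
  also have "\<dots> = {1..r}"
    using labels \<open>f 0 = g y\<close> r_pos by auto
  finally have g_verts: "g ` pverts R = {1..r}" .
  have "f ` pverts (star m) = insert (f 0) (f ` (pverts (star m) - {0}))"
    using \<open>m \<ge> 1\<close> by (force simp: S)
  also have "\<dots> = {r..r + m - 1}"
    using labels \<open>m \<ge> 1\<close> by auto
  finally have f_verts: "f ` pverts (star m) = {r..r + m - 1}" .
  show T_verts: "pverts T = {1..r + m - 1}"
    using coal f_verts g_verts r_pos \<open>m \<ge> 1\<close> by (auto simp: is_coalescence_def relabel_def)
  show "r \<ge> 1" "m \<ge> 1"
    by fact+
  show "a = r" if arc: "(a, l) \<in> parcs T" and "l > r" for a l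
  proof -
    have "l \<notin> g ` pverts R"
      using \<open>l > r\<close> by (simp add: g_verts)
    then have "(a, l) \<notin> map_prod g g ` parcs R"
      using R.in_arcsD2 by auto
    then have "(a, l) \<in> map_prod f f ` parcs (star m)"
      using arc coal by (auto simp: is_coalescence_def relabel_def)
    then show ?thesis
      using \<open>l > r\<close> labels by (auto simp: S)
  qed
qed

section \<open>The recurrence for distance matrices\<close>

text \<open>The vertices \<open>k + 1\<close> and \<open>k + 2\<close> lie beyond \<open>R\<close>,
  hence are leaves at the same vertex; in matrix indices they are \<open>k\<close> and
  \<open>Suc k\<close>.\<close>

lemma det_distance_matrix_star_coalescence:
  fixes T :: "nat pair_pre_digraph" and R :: "'b pair_pre_digraph"
  assumes R: "is_tree R" and T: "is_tree T"
    and coal: "is_coalescence T (star m) 0 R y f g" and lab: "is_labelling (star m) 0 R y f g"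
    and k: "card (pverts R) \<le> k" "k + 2 \<le> card (pverts T)"
  defines "D \<equiv> \<lambda>k. distance_matrix (with_proj T \<restriction> {1..k})"
  shows "det (D (k + 2)) + 4 * det (D (k + 1)) + 4 * det (D k) = 0"
proof -
  define r where "r = card (pverts R)"
  interpret pair_graph T
    using T by (simp add: is_tree_def)
  note sc = star_coalescence[OF R coal lab, folded r_def]
  note T_verts = sc(3) and leaf = sc(4)
  define d where "d i j = tree_dist (with_proj T) (Suc i) (Suc j)" for i j
  \<comment> \<open>All vertices outside \<open>{1..k'}\<close> are leaves at \<open>r\<close>, so
    every \<open>D k'\<close> in this range is a leading block of the one array
    \<open>d\<close>.\<close>
  have D_eq: "D k' = mat k' k' (\<lambda>(i, j). real (d i j))" if "r \<le> k'" "k' \<le> r + m - 1" for k'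
  proof -
    have "tree_dist (with_proj T \<restriction> {1..k'}) u v = tree_dist (with_proj T) u v"
      if "u \<in> {1..k'}" "v \<in> {1..k'}" for u v
    proof -
      have "x = r" if "(x, l) \<in> parcs T" "l \<notin> {1..k'}" for x l
        using leaf[of x l] that \<open>r \<le> k'\<close> in_arcsD2[of x l] by (auto simp: T_verts)
      then have "pre_digraph.apath (with_proj T \<restriction> {1..k'}) u p v \<longleftrightarrow> apath u p v" for p
        using that \<open>k' \<le> r + m - 1\<close> by (intro apath_induce_iff[where r = r]) (auto simp: T_verts)
      then show ?thesis
        by (simp add: tree_dist_def)
    qed
    then show ?thesis
      unfolding D_def distance_matrix_def d_def by (intro eq_matI) auto
  qed
  have kn: "r \<le> k" "k + 2 \<le> r + m - 1"
    using k by (auto simp: r_def T_verts)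
  have vert: "Suc i \<in> pverts T" if "i < k + 2" for i
    using that kn by (auto simp: T_verts)
  \<comment> \<open>The right-hand side does not mention \<open>j\<close>, which makes the two leaf
    columns agree.\<close>
  have leaf_dist: "d i j = tree_dist (with_proj T) (Suc i) r + 1"
    if "i < k + 2" "j \<in> {k, Suc k}" "i \<noteq> j" for i j
    unfolding d_def using that vert leaf[of _ "Suc j"] kn
    by (intro tree_dist_leaf[OF T]) auto
  have sym: "d i j = d j i" if "i < k + 2" "j < k + 2" for i j
    unfolding d_def using that vert by (intro tree_dist_sym[OF T]) auto
  have refl: "d i i = 0" if "i < k + 2" for i
    unfolding d_def using that vert by (intro tree_dist_refl[OF T]) auto
  \<comment> \<open>With \<open>leaf_dist\<close> this puts the two leaves at distance 2.\<close>
  have centre: "tree_dist (with_proj T) (Suc i) r = 1" if "i \<in> {k, Suc k}" for i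
  proof -
    have r: "r \<in> pverts T"
      using sc(1,2) by (auto simp: T_verts)
    have "tree_dist (with_proj T) r (Suc i) = tree_dist (with_proj T) r r + 1"
      using that r vert leaf[of _ "Suc i"] kn by (intro tree_dist_leaf[OF T]) auto
    then show ?thesis
      using tree_dist_refl[OF T r] tree_dist_sym[OF T r vert[of i]] that by auto
  qed
  have "det (mat (k + 2) (k + 2) (\<lambda>(i, j). real (d i j)))
      + 4 * det (mat (k + 1) (k + 1) (\<lambda>(i, j). real (d i j)))
      + 4 * det (mat k k (\<lambda>(i, j). real (d i j))) = 0"
  proof (rule det_two_twin_leaves)
    show col: "real (d i (Suc k)) = real (d i k)" if "i < k" for i
      using that by (simp add: leaf_dist)
    show "real (d (Suc k) j) = real (d k j)" if "j < k" for j
      using col[OF that] sym[of j k] sym[of j "Suc k"] that by simp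
  qed (auto simp: refl leaf_dist centre)
  then show ?thesis
    using kn by (simp add: D_eq)
qed

theorem theorem1:
  fixes m :: nat
  assumes "m \<in> {4, 5, 6, 7}"
  shows "\<exists>(S :: nat pair_pre_digraph) (x :: nat) (c :: nat \<Rightarrow> real).
    is_tree S \<and> card (pverts S) = m \<and> x \<in> pverts S \<and> c (m - 1) \<noteq> 0 \<and>
    (\<forall>(R :: nat pair_pre_digraph) (T :: nat pair_pre_digraph) (n :: nat) y f g.
       is_tree R \<and> is_tree T \<and> card (pverts T) = n \<and>
       is_coalescence T S x R y f g \<and> is_labelling S x R y f g \<longrightarrow>
       (let D = (\<lambda>k. distance_matrix (with_proj T \<restriction> {1..k})) in
          det (D n) + (\<Sum>i = 1..m - 1. c i * det (D (n - i))) = 0))"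
proof -
  \<comment> \<open>Coefficients of \<open>(E\<^sup>2 + 4 E + 4) (E\<^bsup>m - 3\<^esup> + 1)\<close> with \<open>E\<close> the shift; the factor
    \<open>E\<^bsup>m - 3\<^esup> + 1\<close> only raises the order to \<open>m - 1\<close> and keeps the last coefficient nonzero.\<close>
  define c :: "nat \<Rightarrow> real" where "c i = (if i = 1 \<or> i = 2 then 4 else 0) +
    (if i = m - 3 then 1 else if i = m - 2 \<or> i = m - 1 then 4 else 0)" for i
  have recurrence: "det (D n) + (\<Sum>i = 1..m - 1. c i * det (D (n - i))) = 0"
    if R: "is_tree R" and T: "is_tree T" "card (pverts T) = n"
      and coal: "is_coalescence T (star m) 0 R y f g" and lab: "is_labelling (star m) 0 R y f g"
      and D: "D = (\<lambda>k. distance_matrix (with_proj T \<restriction> {1..k}))"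
    for R T :: "nat pair_pre_digraph" and n y f g D
  proof -
    have m: "m \<ge> 4"
      using assms by auto
    have n: "n = card (pverts R) + m - 1"
      using star_coalescence(3)[OF R coal lab] T by simp
    have r: "card (pverts R) \<ge> 1"
      using star_coalescence(1)[OF R coal lab] .
    have step: "det (D (k + 2)) + 4 * det (D (k + 1)) + 4 * det (D k) = 0"
      if "n - m + 1 \<le> k" "k + 2 \<le> n" for k
      unfolding D using det_distance_matrix_star_coalescence[OF R T(1) coal lab, of k] that m n r T
      by auto
    \<comment> \<open>The recurrence is the sum of the three-term relation at the largest possible
      \<open>k\<close>, namely \<open>n - 2\<close>, and, in \<open>bot\<close>, at the smallest,
      \<open>n - (m - 1) = card (pverts R)\<close>.\<close>
    have top: "det (D n) + 4 * det (D (n - 1)) + 4 * det (D (n - 2)) = 0"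
      using step[of "n - 2"] n m r by (simp add: numeral_2_eq_2 Suc_diff_Suc)
    have bot: "det (D (n - (m - 3))) + 4 * det (D (n - (m - 2))) + 4 * det (D (n - (m - 1))) = 0"
    proof -
      have "n - (m - 1) + 2 = n - (m - 3)" "n - (m - 1) + 1 = n - (m - 2)" "n - m + 1 \<le> n - (m - 1)"
        using n m r by auto
      then show ?thesis
        using step[of "n - (m - 1)"] m by simp
    qed
    have "m = 4 \<or> m = 5 \<or> m = 6 \<or> m = 7"
      using assms by simp
    then show ?thesis
      using top bot
      by (elim disjE) (simp_all add: c_def numeral_eq_Suc algebra_simps)
  qed
  \<comment> \<open>Since \<open>m - 1\<close> exceeds 2, only the second summand of
    \<open>c\<close> contributes, with value 4.\<close>
  have "c (m - 1) \<noteq> 0"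
    using assms by (auto simp: c_def)
  then show ?thesis
    using assms is_tree_star[of m] recurrence
    by (intro exI[of _ "star m"] exI[of _ 0] exI[of _ c]) (auto simp: star_def Let_def)
qed

end
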